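(* Let $W(x,y)$ be a formal weight enumerator of degree $n$ of the form $W(x,y)=x^n+\sum_{i=d}^n A_i x^{n-i}y^i$ with $A_d\neq 0$, $d\ge1$, and let $P(T)$ be its zeta polynomial. Put $g=\frac{n}{2}+1-d$. Then $P(T)$ has degree $2g$ and satisfies $$P(T)=-P\Bigl(\frac{1}{2T}\Bigr)2^g T^{2g}.$$
   Context: A formal weight enumerator is a homogeneous polynomial $W(x,y)=\sum_{i=0}^n A_i x^{n-i}y^i\in\mathbf{C}[x,y]$ such that (i) $A_i\neq 0$ implies $4\mid i$, and (ii) $W\left(\frac{x+y}{\sqrt 2},\frac{x-y}{\sqrt 2}\right)=-W(x,y)$. For $W(x,y)=x^n+\sum_{i=d}^n A_i x^{n-i}y^i$ ($A_d\ne0$), its zeta polynomial (with $q=2$) is the unique polynomial $P(T)\in\mathbf{C}[T]$ of degree at most $n-d$ such that, in the power series expansion in $T$ of $$\frac{P(T)}{(1-T)(1-2T)}\,(y(1-T)+xT)^n,$$ the coefficient of $T^{n-d}$ equals $\frac{W(x,y)-x^n}{2-1}=W(x,y)-x^n$. *)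

theory Defs
  imports Complex_Main "HOL-Computational_Algebra.Computational_Algebra"
begin

text \<open>
  The ring \<open>\<complex>[x, y]\<close> is the type \<open>complex poly poly\<close>, read as \<open>(\<complex>[x])[y]\<close>:
  the inner indeterminate is \<open>x\<close>, the outer one is \<open>y\<close>.
\<close>

definition const_xy :: "complex \<Rightarrow> complex poly poly" where
  "const_xy c = [:[:c:]:]"

definition var_x :: "complex poly poly" where
  "var_x = [:[:0, 1:]:]"

definition var_y :: "complex poly poly" where
  "var_y = [:0, 1:]"

text \<open>
  The binary form with coefficients \<open>A\<^sub>0, \<dots>, A\<^sub>n\<close>, with the polynomials \<open>u\<close> and \<open>v\<close>
  substituted for its two indeterminates.
\<close>

definition binary_form ::
  "nat \<Rightarrow> (nat \<Rightarrow> complex) \<Rightarrow> complex poly poly \<Rightarrow> complex poly poly \<Rightarrow> complex poly poly" where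
  "binary_form n A u v = (\<Sum>i=0..n. const_xy (A i) * u ^ (n - i) * v ^ i)"

definition formal_weight_enumerator :: "nat \<Rightarrow> complex poly poly \<Rightarrow> bool" where
  "formal_weight_enumerator n W \<longleftrightarrow>
     (\<exists>A. W = binary_form n A var_x var_y \<and>
          (\<forall>i\<le>n. A i \<noteq> 0 \<longrightarrow> 4 dvd i) \<and>
          binary_form n A (const_xy (1 / complex_of_real (sqrt 2)) * (var_x + var_y))
                          (const_xy (1 / complex_of_real (sqrt 2)) * (var_x - var_y)) = - W)"

text \<open>
  The series \<open>P(T) / ((1 - T)(1 - 2T)) \<cdot> (y(1 - T) + xT)\<^sup>n\<close> in \<open>\<complex>[x, y][[T]]\<close>.  The quotient
  is formed in \<open>\<complex>[[T]]\<close>, where the denominator is a unit, and then mapped coefficientwise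
  into \<open>\<complex>[x, y][[T]]\<close>.
\<close>

definition zeta_series :: "nat \<Rightarrow> complex poly \<Rightarrow> complex poly poly fps" where
  "zeta_series n P =
     Abs_fps (\<lambda>k. const_xy (fps_nth (fps_of_poly P / ((1 - fps_X) * (1 - 2 * fps_X))) k)) *
     (fps_const var_y * (1 - fps_X) + fps_const var_x * fps_X) ^ n"

definition zeta_polynomial :: "nat \<Rightarrow> nat \<Rightarrow> complex poly poly \<Rightarrow> complex poly" where
  "zeta_polynomial n d W =
     (THE P. degree P \<le> n - d \<and> fps_nth (zeta_series n P) (n - d) = W - var_x ^ n)"

end

theory Submission
  imports Defs
begin

text \<open>
  Expand \<open>W\<close> in the basis \<open>(x - y)\<^sup>j y\<^sup>n\<^sup>-\<^sup>j\<close>, writing its coefficients as \<open>c\<^sub>j \<cdot> (n choose j)\<close>.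
  Since \<open>(y(1 - T) + xT)\<^sup>n = (y + (x - y)T)\<^sup>n\<close>, the definition of \<open>P\<close> says that the coefficient
  of \<open>T\<^sup>k\<close> in \<open>P(T) / ((1 - T)(1 - 2T))\<close> is \<open>c\<^sub>j - 1\<close> with \<open>j = n - d - k\<close>, and the MacWilliams
  identity becomes \<open>c\<^sub>n\<^sub>-\<^sub>j = - s\<^sup>2\<^sup>j\<^sup>-\<^sup>n c\<^sub>j\<close> with \<open>s = sqrt 2\<close>.  As \<open>c\<^sub>j = 1\<close> for \<open>j > n - d\<close>, this
  symmetry extends \<open>c\<close> to all integers, with \<open>c\<^sub>j\<close> proportional to \<open>2\<^sup>-\<^sup>j\<close> for \<open>j < d\<close>.  Multiplication by
  \<open>(1 - T)(1 - 2T)\<close> annihilates both tails, so \<open>P\<close> is a finite sum that inherits the symmetry.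
\<close>

section \<open>Coefficients of the zeta series in powers of x - y and y\<close>

lemma zeta_kernel_nth:
  "fps_nth ((fps_const v * (1 - fps_X) + fps_const u * fps_X) ^ n :: 'a::comm_ring_1 fps) j
     = of_nat (n choose j) * (u - v) ^ j * v ^ (n - j)"
proof -
  have eq: "fps_const v * (1 - fps_X) + fps_const u * fps_X
      = fps_const (u - v) * fps_X + fps_const v"
    by (simp add: algebra_simps flip: fps_const_sub)
  have "(fps_const v * (1 - fps_X) + fps_const u * fps_X) ^ n
      = (\<Sum>k\<le>n. fps_const (of_nat (n choose k) * (u - v) ^ k * v ^ (n - k)) * fps_X ^ k)"
    unfolding eq binomial_ring
    by (simp add: power_mult_distrib fps_of_nat[symmetric] mult_ac del: fps_of_nat flip: fps_const_mult fps_const_power)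
  also have "fps_nth \<dots> j = of_nat (n choose j) * (u - v) ^ j * v ^ (n - j)"
    by (simp add: fps_sum_nth if_distrib[of "\<lambda>z. _ * z"] sum.delta' not_le binomial_eq_0 cong: if_cong)
  finally show ?thesis .
qed

lemma zeta_series_nth:
  "fps_nth (zeta_series n P) r =
     (\<Sum>j\<le>r. const_xy (fps_nth (fps_of_poly P / ((1 - fps_X) * (1 - 2 * fps_X))) (r - j)) *
        (of_nat (n choose j) * (var_x - var_y) ^ j * var_y ^ (n - j)))"
proof -
  have "fps_nth (zeta_series n P) r =
     (\<Sum>i=0..r. const_xy (fps_nth (fps_of_poly P / ((1 - fps_X) * (1 - 2 * fps_X))) i) *
        (of_nat (n choose (r - i)) * (var_x - var_y) ^ (r - i) * var_y ^ (n - (r - i))))"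
    unfolding zeta_series_def fps_mult_nth by (simp add: zeta_kernel_nth)
  also have "\<dots> = (\<Sum>j\<le>r. const_xy (fps_nth (fps_of_poly P / ((1 - fps_X) * (1 - 2 * fps_X))) (r - j)) *
        (of_nat (n choose j) * (var_x - var_y) ^ j * var_y ^ (n - j)))"
    by (rule sum.reindex_bij_witness[of _ "\<lambda>j. r - j" "\<lambda>i. r - i"]) auto
  finally show ?thesis .
qed

text \<open>Point evaluation turns identities in two indeterminates into identities of functions of
  one complex variable, where coefficients can be compared by
  \<open>polyfun_eq_coeffs\<close>.\<close>

definition eval_xy :: "complex \<Rightarrow> complex \<Rightarrow> complex poly poly \<Rightarrow> complex" where
  "eval_xy a b f = poly (poly f [:b:]) a"

lemma eval_xy_simps [simp]:
  "eval_xy a b (f + h) = eval_xy a b f + eval_xy a b h"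
  "eval_xy a b (f - h) = eval_xy a b f - eval_xy a b h"
  "eval_xy a b (- f) = - eval_xy a b f"
  "eval_xy a b (f * h) = eval_xy a b f * eval_xy a b h"
  "eval_xy a b (f ^ k) = eval_xy a b f ^ k"
  "eval_xy a b (sum F I) = (\<Sum>i\<in>I. eval_xy a b (F i))"
  "eval_xy a b (of_nat k) = of_nat k"
  "eval_xy a b var_x = a"
  "eval_xy a b var_y = b"
  "eval_xy a b (const_xy c) = c"
  by (simp_all add: eval_xy_def poly_sum var_x_def var_y_def const_xy_def)

lemma const_xy_add: "const_xy (a + b) = const_xy a + const_xy b"
  by (simp add: const_xy_def)

lemma const_xy_sum: "const_xy (sum f I) = (\<Sum>i\<in>I. const_xy (f i))"
  by (induction I rule: infinite_finite_induct) (simp_all add: const_xy_add, simp_all add: const_xy_def)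

lemma const_xy_mult: "const_xy (a * b) = const_xy a * const_xy b"
  by (simp add: const_xy_def)

lemma const_xy_of_nat: "const_xy (of_nat k) = of_nat k"
  by (simp add: const_xy_def of_nat_poly)

section \<open>Uniqueness of the zeta polynomial\<close>

lemma zeta_denominator:
  "(1 - fps_X) * (1 - 2 * fps_X) = (1 - 3 * fps_X + 2 * fps_X ^ 2 :: complex fps)"
  by (simp add: algebra_simps power2_eq_square)

lemma zeta_quotient_mult:
  fixes F :: "complex fps"
  shows "F / ((1 - fps_X) * (1 - 2 * fps_X)) * ((1 - fps_X) * (1 - 2 * fps_X)) = F"
proof -
  define D :: "complex fps" where "D = (1 - fps_X) * (1 - 2 * fps_X)"
  have "fps_nth D 0 \<noteq> 0" by (simp add: D_def)
  then have "F / D * D = F"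
    by (simp add: fps_divide_unit inverse_mult_eq_1 mult.assoc)
  then show ?thesis by (simp add: D_def)
qed

text \<open>At x = u + 1, y = 1 the basis element (x - y)^j y^(n-j) becomes u^j, and
  \<open>n choose j\<close> is nonzero for j \<le> r \<le> n, so the two quotient series agree up to
  T^r. Multiplying back by the denominator recovers the polynomial coefficients up to degree
  \<open>r\<close>; the degree bounds settle the rest.\<close>

lemma zeta_polynomial_unique:
  assumes "degree P \<le> r" "degree Q \<le> r" "r \<le> n"
    and eq: "fps_nth (zeta_series n P) r = fps_nth (zeta_series n Q) r"
  shows "P = Q"
proof -
  define D :: "complex fps" where "D = (1 - fps_X) * (1 - 2 * fps_X)"
  define f where "f = (\<lambda>P. fps_nth (fps_of_poly P / D))"
  have ev: "eval_xy (u + 1) 1 (fps_nth (zeta_series n R) r)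
      = (\<Sum>j\<le>r. (f R (r - j) * of_nat (n choose j)) * u ^ j)" for u R
    by (simp add: zeta_series_nth f_def D_def mult_ac)
  have "(\<Sum>j\<le>r. (f P (r - j) * of_nat (n choose j)) * u ^ j)
      = (\<Sum>j\<le>r. (f Q (r - j) * of_nat (n choose j)) * u ^ j)" for u
    unfolding ev[symmetric] eq ..
  then have "\<forall>j\<le>r. f P (r - j) * of_nat (n choose j) = f Q (r - j) * of_nat (n choose j)"
    using polyfun_eq_coeffs[where n = r and c = "\<lambda>j. f P (r - j) * of_nat (n choose j)"
        and d = "\<lambda>j. f Q (r - j) * of_nat (n choose j)"] by blast
  then have "f P (r - j) = f Q (r - j)" if "j \<le> r" for j
    using that \<open>r \<le> n\<close> by (auto simp: binomial_eq_0_iff)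
  then have fPQ: "f P k = f Q k" if "k \<le> r" for k
    using that by (metis diff_diff_cancel diff_le_self)
  have "coeff P k = coeff Q k" for k
  proof (cases "k \<le> r")
    case True
    have "coeff R k = (\<Sum>i=0..k. f R i * fps_nth D (k - i))" for R
    proof -
      have "coeff R k = fps_nth (fps_of_poly R / D * D) k"
        by (simp add: D_def zeta_quotient_mult)
      then show ?thesis by (simp add: fps_mult_nth f_def)
    qed
    then show ?thesis using True fPQ by simp
  next
    case False
    then show ?thesis using assms(1,2) by (simp add: coeff_eq_0)
  qed
  then show ?thesis by (rule poly_eqI)
qed

text \<open>Uniqueness turns the definite description into a check of one explicit candidate, built
  as \<open>Q\<close> in the main proof.\<close>

lemma zeta_polynomial_eqI:
  assumes "degree P \<le> n - d" "fps_nth (zeta_series n P) (n - d) = W - var_x ^ n"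
  shows "zeta_polynomial n d W = P"
  unfolding zeta_polynomial_def
  using assms by (intro the_equality) (auto intro: zeta_polynomial_unique[of _ "n - d" _ n])

section \<open>Divisibility and the MacWilliams identity in usable form\<close>

lemma coeff_const_xy_monomial:
  "coeff (const_xy c * var_x ^ k * var_y ^ i) j = (if i = j then monom c k else 0)"
proof -
  have y: "var_y ^ i = monom 1 i"
    by (simp add: var_y_def monom_altdef)
  have x: "const_xy c * var_x ^ k = [:monom c k:]"
    by (simp add: var_x_def const_xy_def poly_const_pow monom_altdef)
  show ?thesis unfolding x y by simp
qed

text \<open>Comparing coefficients of y^d identifies \<open>A d\<close> with the witness hidden in
  the definition; d \<ge> 1 keeps x^n out of the comparison.\<close>

lemma formal_weight_enumerator_dvd:
  assumes "formal_weight_enumerator n W"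
    and "W = var_x ^ n + (\<Sum>i=d..n. const_xy (A i) * var_x ^ (n - i) * var_y ^ i)"
    and "1 \<le> d" "d \<le> n" "A d \<noteq> 0"
  shows "4 dvd d"
proof -
  obtain B where B: "W = binary_form n B var_x var_y" "\<forall>i\<le>n. B i \<noteq> 0 \<longrightarrow> 4 dvd i"
    using assms(1) by (auto simp: formal_weight_enumerator_def)
  have "coeff W d = monom (B d) (n - d)"
    using assms(4) by (simp add: B(1) binary_form_def coeff_sum coeff_const_xy_monomial)
  moreover have "coeff (var_x ^ n) d = 0"
    using assms(3) coeff_const_xy_monomial[of 1 n 0 d] by (simp add: const_xy_def flip: one_pCons)
  then have "coeff W d = monom (A d) (n - d)"
    using assms(4) by (simp add: assms(2) coeff_sum coeff_const_xy_monomial)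
  ultimately have "B d = A d" by (metis coeff_monom)
  with B(2) assms(4,5) show ?thesis by simp
qed

lemma formal_weight_enumerator_eval:
  assumes "formal_weight_enumerator n W"
  shows "eval_xy ((a + b) / complex_of_real (sqrt 2)) ((a - b) / complex_of_real (sqrt 2)) W
    = - eval_xy a b W"
proof -
  let ?s = "complex_of_real (sqrt 2)"
  obtain B where B: "W = binary_form n B var_x var_y"
      "binary_form n B (const_xy (1 / ?s) * (var_x + var_y)) (const_xy (1 / ?s) * (var_x - var_y)) = - W"
    using assms by (auto simp: formal_weight_enumerator_def)
  have "- eval_xy a b W = eval_xy a b
      (binary_form n B (const_xy (1 / ?s) * (var_x + var_y)) (const_xy (1 / ?s) * (var_x - var_y)))"
    by (simp add: B(2))
  also have "\<dots> = eval_xy ((a + b) / ?s) ((a - b) / ?s) (binary_form n B var_x var_y)"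
    by (simp add: binary_form_def)
  finally show ?thesis by (simp add: B(1))
qed

section \<open>Degree and functional equation\<close>

theorem theorem3p1:
  fixes n d :: nat and A :: "nat \<Rightarrow> complex" and W :: "complex poly poly"
    and P :: "complex poly" and g :: real
  assumes "formal_weight_enumerator n W"
    and "W = var_x ^ n + (\<Sum>i=d..n. const_xy (A i) * var_x ^ (n - i) * var_y ^ i)"
    and "1 \<le> d" and "d \<le> n" and "A d \<noteq> 0"
  defines "P \<equiv> zeta_polynomial n d W"
    and "g \<equiv> real n / 2 + 1 - real d"
  shows "real (degree P) = 2 * g \<and>
    (\<forall>T::complex. T \<noteq> 0 \<longrightarrow>
       poly P T = - poly P (1 / (2 * T)) * complex_of_real (2 powr g) * T powi \<lfloor>2 * g\<rfloor>)"
proof -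
  define s where "s = complex_of_real (sqrt 2)"
  have s2: "s * s = 2" by (simp add: s_def flip: of_real_mult)
  have s0: "s \<noteq> 0" by (simp add: s_def)
  have s_pow: "s ^ 2 = 2" by (simp add: s2 power2_eq_square)
  \<comment> \<open>Divisibility is essential: for \<open>d = 1\<close> the degree bound \<open>n - d\<close> would be smaller than \<open>2g\<close>.\<close>
  have d4: "4 \<le> d"
    using formal_weight_enumerator_dvd[OF assms(1-5)] assms(3) by (auto elim: dvdE)
  define r where "r = n - d"
  \<comment> \<open>These are the numbers c_j - 1: expanding x^(n-i) = ((x - y) + y)^(n-i) in W -
    x^n gives the numerator, while x^n itself would contribute 1 for every j \<le> n. For j > n both
    numerator and denominator are 0.\<close>
  define b where "b = (\<lambda>j. (\<Sum>i=d..n. A i * of_nat ((n - i) choose j)) / of_nat (n choose j))"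
  have b_mult: "b j * of_nat (n choose j) = (\<Sum>i=d..n. A i * of_nat ((n - i) choose j))"
    if "j \<le> n" for j using that by (simp add: b_def)
  have b_0: "b j = 0" if "j > r" for j
    using that by (auto simp: b_def r_def intro!: sum.neutral)
  \<comment> \<open>For i > d the upper index n - i lies below \<open>r\<close>, so only i = d
    contributes.\<close>
  have b_r: "b r \<noteq> 0"
  proof -
    have "(\<Sum>i=d..n. A i * of_nat ((n - i) choose r)) = (\<Sum>i\<in>{d}. A i * of_nat ((n - i) choose r))"
      using assms(4) by (intro sum.mono_neutral_right) (auto simp: r_def)
    then show ?thesis using assms(4,5) by (simp add: b_def r_def)
  qed
  have W_b: "W - var_x ^ n
     = (\<Sum>j\<le>n. const_xy (b j) * (of_nat (n choose j) * (var_x - var_y) ^ j * var_y ^ (n - j)))"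
  proof -
    have "const_xy (A i) * var_x ^ (n - i) * var_y ^ i
        = (\<Sum>j\<le>n. const_xy (A i) * (of_nat ((n - i) choose j) * (var_x - var_y) ^ j * var_y ^ (n - j)))"
      if "i \<le> n" for i
    proof -
      have "var_x ^ (n - i) = ((var_x - var_y) + var_y) ^ (n - i)" by simp
      also have "\<dots> = (\<Sum>j\<le>n - i. of_nat ((n - i) choose j) * (var_x - var_y) ^ j * var_y ^ (n - i - j))"
        by (rule binomial_ring)
      also have "\<dots> * var_y ^ i = (\<Sum>j\<le>n - i. of_nat ((n - i) choose j) * (var_x - var_y) ^ j * var_y ^ (n - j))"
        unfolding sum_distrib_right using that
        by (intro sum.cong) (auto simp: mult.assoc simp flip: power_add)
      also have "\<dots> = (\<Sum>j\<le>n. of_nat ((n - i) choose j) * (var_x - var_y) ^ j * var_y ^ (n - j))"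
        by (intro sum.mono_neutral_left) (auto simp: binomial_eq_0)
      finally show ?thesis by (simp add: mult.assoc sum_distrib_left)
    qed
    then have "W - var_x ^ n = (\<Sum>i=d..n. \<Sum>j\<le>n. const_xy (A i) *
        (of_nat ((n - i) choose j) * (var_x - var_y) ^ j * var_y ^ (n - j)))"
      unfolding assms(2) by simp
    also have "\<dots> = (\<Sum>j\<le>n. (\<Sum>i=d..n. const_xy (A i * of_nat ((n - i) choose j))) *
        ((var_x - var_y) ^ j * var_y ^ (n - j)))"
      by (subst sum.swap) (simp add: sum_distrib_right const_xy_mult const_xy_of_nat mult.assoc)
    also have "\<dots> = (\<Sum>j\<le>n. const_xy (b j * of_nat (n choose j)) *
        ((var_x - var_y) ^ j * var_y ^ (n - j)))"
      by (simp add: b_mult const_xy_sum)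
    finally show ?thesis by (simp add: const_xy_mult const_xy_of_nat mult.assoc)
  qed
  have W_eval: "eval_xy (u + v) v W = (\<Sum>j\<le>n. (1 + b j) * of_nat (n choose j) * u ^ j * v ^ (n - j))" for u v
  proof -
    have "eval_xy (u + v) v W = eval_xy (u + v) v (W - var_x ^ n) + (u + v) ^ n" by simp
    also have "\<dots> = (\<Sum>j\<le>n. (1 + b j) * of_nat (n choose j) * u ^ j * v ^ (n - j))"
      unfolding W_b by (simp add: binomial_ring ring_distribs sum.distrib mult.assoc)
    finally show ?thesis .
  qed
  have mac_williams: "1 + b (n - j) = - (s powi (2 * int j - int n)) * (1 + b j)" if "j \<le> n" for j
  proof -
    have "(\<Sum>i\<le>n. ((1 + b (n - i)) * of_nat (n choose i) * s powi (int n - 2 * int i)) * u ^ i)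
        = (\<Sum>i\<le>n. (- (1 + b i) * of_nat (n choose i)) * u ^ i)" for u
    proof -
      \<comment> \<open>The MacWilliams substitution sends (x - y, y) to (s y, (x - y)/s): the two
        basis factors swap up to scaling, so index j meets n - j. The point x = u + 1, y = 1 makes
        both sides polynomials in \<open>u\<close>.\<close>
      have "- eval_xy (u + 1) 1 W = eval_xy (s * 1 + u / s) (u / s) W"
      proof -
        have "(u + 1 + 1) / s = s * 1 + u / s" using s0 by (simp add: field_simps s2)
        then show ?thesis
          using formal_weight_enumerator_eval[OF assms(1), of "u + 1" 1] by (simp add: s_def)
      qed
      also have "\<dots> = (\<Sum>j\<le>n. (1 + b j) * of_nat (n choose j) * s ^ j * (u / s) ^ (n - j))"
        using W_eval[of s "u / s"] by simp
      also have "\<dots> = (\<Sum>i\<le>n. (1 + b (n - i)) * of_nat (n choose i) * s ^ (n - i) * (u / s) ^ i)"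
        by (rule sum.reindex_bij_witness[of _ "\<lambda>j. n - j" "\<lambda>i. n - i"])
          (auto simp: binomial_symmetric[symmetric])
      also have "\<dots> = (\<Sum>i\<le>n. ((1 + b (n - i)) * of_nat (n choose i) * s powi (int n - 2 * int i)) * u ^ i)"
      proof (intro sum.cong refl)
        fix i assume "i \<in> {..n}"
        then have "int n - 2 * int i = int (n - i) - int i" by simp
        then have "s powi (int n - 2 * int i) = s ^ (n - i) / s ^ i"
          using s0 by (metis power_int_diff power_int_of_nat)
        then show "(1 + b (n - i)) * of_nat (n choose i) * s ^ (n - i) * (u / s) ^ i
            = (1 + b (n - i)) * of_nat (n choose i) * s powi (int n - 2 * int i) * u ^ i"
          by (simp add: power_divide)
      qed
      finally show ?thesis by (simp only: W_eval power_one mult_1_right mult_minus_left sum_negf)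
    qed
    then have "(1 + b (n - j)) * of_nat (n choose j) * s powi (int n - 2 * int j)
        = - (1 + b j) * of_nat (n choose j)"
      using that polyfun_eq_coeffs[where n = n
          and c = "\<lambda>i. (1 + b (n - i)) * of_nat (n choose i) * s powi (int n - 2 * int i)"
          and d = "\<lambda>i. - (1 + b i) * of_nat (n choose i)"] by blast
    then have "(1 + b (n - j)) * s powi (int n - 2 * int j) = - (1 + b j)"
      using that by (simp add: mult.commute mult.left_commute)
    then have "(1 + b (n - j)) * (s powi (int n - 2 * int j) * s powi (2 * int j - int n))
        = - (1 + b j) * s powi (2 * int j - int n)"
      by (metis mult.assoc)
    moreover have "s powi (int n - 2 * int j) * s powi (2 * int j - int n) = 1"
      using s0 by (simp flip: power_int_add)
    ultimately show ?thesis by (simp add: algebra_simps)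
  qed
  \<comment> \<open>The value at j < 0 is forced by the symmetry, since its mirror image n - j lies
    where \<open>c\<close> is 1.\<close>
  define c where "c = (\<lambda>j::int. if 0 \<le> j then 1 + b (nat j) else - (s powi (int n - 2 * j)))"
  have c_1: "c j = 1" if "j > int r" for j
    using that b_0[of "nat j"] by (simp add: c_def)
  have c_sym: "c (int n - j) = - (s powi (2 * j - int n)) * c j" for j
  proof -
    consider "j < 0" | "0 \<le> j" "j \<le> int n" | "j > int n" by linarith
    then show ?thesis
    proof cases
      case 1
      then have "c (int n - j) = 1" by (intro c_1) (simp add: r_def)
      then show ?thesis using 1 s0 by (simp add: c_def flip: power_int_add)
    next
      case 2
      then show ?thesis using mac_williams[of "nat j"] by (simp add: c_def nat_diff_distrib)
    next
      case 3
      then have "c j = 1" by (intro c_1) (simp add: r_def)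
      then show ?thesis using 3 by (simp add: c_def)
    qed
  qed
  \<comment> \<open>Otherwise d - 1 and its mirror image n - d + 1 both exceed n - d, so
    \<open>c\<close> is 1 at both, whereas \<open>c_sym\<close> makes their ratio negative.\<close>
  have d2: "2 * d \<le> n + 1"
  proof (rule ccontr)
    assume "\<not> 2 * d \<le> n + 1"
    then have "c (int n - int (d - 1)) = 1" "c (int (d - 1)) = 1"
      using d4 assms(4) by (auto intro!: c_1 simp: r_def)
    then have "s powi (2 * int (d - 1) - int n) = -1"
      using c_sym[of "int (d - 1)"] by (metis minus_equation_iff mult_1_right)
    moreover have "s powi k = complex_of_real (sqrt 2 powi k)" for k
      by (simp add: s_def)
    ultimately have "sqrt 2 powi (2 * int (d - 1) - int n) = -1"
      by (metis of_real_1 of_real_eq_iff of_real_minus)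
    moreover have "sqrt 2 powi (2 * int (d - 1) - int n) > 0"
      by (simp add: zero_less_power_int)
    ultimately show False by simp
  qed
  \<comment> \<open>This is 2g; by \<open>d2\<close> the subtraction does not truncate. The
    reflection j -> n - j carries the window r - k, ..., r - k + 2 to the window belonging to N -
    k.\<close>
  define N where "N = n + 2 - 2 * d"
  have N_int: "int N = int n + 2 - 2 * int d" using d2 by (simp add: N_def)
  have N_r: "N \<le> r" using d4 d2 assms(4) by (simp add: N_def r_def)
  have r_int: "int r = int n - int d" using assms(4) by (simp add: r_def)
  \<comment> \<open>The weights come from (1 - T)(1 - 2T) = 1 - 3T + 2T^2. Using \<open>c\<close>
    instead of c - 1 keeps the symmetry and changes nothing, as 1 - 3 + 2 = 0.\<close>
  define p where "p = (\<lambda>k::int. c (int r - k) - 3 * c (int r - k + 1) + 2 * c (int r - k + 2))"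
  have p_neg: "p k = 0" if "k < 0" for k
    using that by (simp add: p_def c_1)
  have p_sym: "p (int N - k) = - (s powi (int N - 2 * k)) * p k" for k
  proof -
    have e: "s powi (m + 2) = 2 * s powi m" "s powi (m + 4) = 4 * s powi m" for m
    proof -
      show "s powi (m + 2) = 2 * s powi m" using s0 by (simp add: power_int_add s_pow)
      then show "s powi (m + 4) = 4 * s powi m"
        using s0 power_int_add[of s "m + 2" 2] by (simp add: s_pow add.assoc)
    qed
    define m where "m = int N - 2 * k - 2"
    have "c (int r - (int N - k)) = - (s powi (m + 4)) * c (int r - k + 2)"
      using c_sym[of "int r - k + 2"] by (simp add: m_def N_int r_int algebra_simps)
    moreover have "c (int r - (int N - k) + 1) = - (s powi (m + 2)) * c (int r - k + 1)"
      using c_sym[of "int r - k + 1"] by (simp add: m_def N_int r_int algebra_simps)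
    moreover have "c (int r - (int N - k) + 2) = - (s powi m) * c (int r - k)"
      using c_sym[of "int r - k"] by (simp add: m_def N_int r_int algebra_simps)
    moreover have "s powi (int N - 2 * k) = 2 * s powi m"
      using e(1)[of m] by (simp add: m_def)
    ultimately show ?thesis
      unfolding p_def e by (simp add: algebra_simps)
  qed
  have p_big: "p (int k) = 0" if "k > N" for k
    using that p_sym[of "int k"] p_neg[of "int N - int k"] s0 by simp
  define Q where "Q = (\<Sum>k\<le>N. monom (p (int k)) k)"
  have Q_coeff: "coeff Q k = p (int k)" for k
    by (simp add: Q_def coeff_sum p_big)
  have Q_poly: "poly Q T = (\<Sum>k\<le>N. p (int k) * T ^ k)" for T
    by (simp add: Q_def poly_sum poly_monom)
  \<comment> \<open>Here p(0) = c(r) - 3 + 2; its nonvanishing passes to p(N) by symmetry and fixes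
    the degree.\<close>
  have "p 0 = b r" by (simp add: p_def c_1) (simp add: c_def)
  then have "p (int N) \<noteq> 0" using p_sym[of 0] b_r s0 by simp
  then have Q_degree: "degree Q = N"
    by (intro antisym degree_le le_degree) (auto simp: Q_coeff p_big)
  \<comment> \<open>Subtracting 1 makes all terms before T^0 vanish by \<open>c_1\<close>, so
    starting the series there loses nothing.\<close>
  define F where "F = Abs_fps (\<lambda>k. c (int r - int k) - 1)"
  have "fps_of_poly Q = F * ((1 - fps_X) * (1 - 2 * fps_X))"
  proof (rule fps_ext)
    fix k :: nat
    have *: "F * ((1 - fps_X) * (1 - 2 * fps_X)) = F - 3 * (F * fps_X) + 2 * (F * fps_X ^ 2)"
      unfolding zeta_denominator by (simp add: algebra_simps)
    consider "k = 0" | "k = 1" | m where "k = m + 2"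
      by (metis One_nat_def add_2_eq_Suc' not0_implies_Suc)
    then show "fps_nth (fps_of_poly Q) k = fps_nth (F * ((1 - fps_X) * (1 - 2 * fps_X))) k"
      unfolding * by cases (simp_all add: Q_coeff p_def F_def c_1 fps_X_power_mult_nth fps_X_power_mult_right_nth
          numeral_fps_const algebra_simps)
  qed
  then have quotient: "fps_of_poly Q / ((1 - fps_X) * (1 - 2 * fps_X)) = F"
    by (metis fps_nonzeroI mult_cancel_right nonzero_mult_div_cancel_right zeta_quotient_mult)
  \<comment> \<open>The coefficient of T^r in the zeta series sees \<open>F\<close> only up to T^r;
    the later terms, from negative indices of \<open>c\<close>, make \<open>Q\<close> a
    polynomial.\<close>
  have F_b: "fps_nth F (r - j) = b j" if "j \<le> r" for j
    using that by (simp add: F_def c_def of_nat_diff)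
  have "P = Q"
    unfolding P_def
  proof (rule zeta_polynomial_eqI)
    show "degree Q \<le> n - d" using N_r by (simp add: Q_degree r_def)
    have "fps_nth (zeta_series n Q) r
      = (\<Sum>j\<le>r. const_xy (b j) * (of_nat (n choose j) * (var_x - var_y) ^ j * var_y ^ (n - j)))"
      by (simp add: zeta_series_nth quotient F_b)
    also have "\<dots> = W - var_x ^ n"
      unfolding W_b by (intro sum.mono_neutral_left) (auto simp: r_def b_0 const_xy_def)
    finally show "fps_nth (zeta_series n Q) (n - d) = W - var_x ^ n" by (simp add: r_def)
  qed
  have g_N: "2 * g = real N" using d2 by (simp add: g_def N_def of_nat_diff)
  then have "g = (1 / 2) * real N" by simp
  then have "2 powr g = (2 powr (1 / 2)) powr real N" by (simp only: powr_powr)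
  then have two_g: "complex_of_real (2 powr g) = s ^ N"
    by (simp add: s_def powr_half_sqrt powr_realpow)
  show ?thesis
  proof (intro conjI allI impI)
    show "real (degree P) = 2 * g" by (simp add: \<open>P = Q\<close> Q_degree g_N)
    fix T :: complex assume T: "T \<noteq> 0"
    \<comment> \<open>After reversal, \<open>p_sym\<close> supplies s^(N-2k) = s^N / 2^k, which
      combines with T^(N-k) into s^N T^N (1/(2T))^k.\<close>
    have "poly Q T = (\<Sum>k\<le>N. p (int N - int k) * T ^ (N - k))"
      unfolding Q_poly
      by (rule sum.reindex_bij_witness[of _ "\<lambda>k. N - k" "\<lambda>k. N - k"]) auto
    also have "\<dots> = (\<Sum>k\<le>N. - (p (int k) * (1 / (2 * T)) ^ k * (s ^ N * T ^ N)))"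
    proof (intro sum.cong refl)
      fix k assume k: "k \<in> {..N}"
      have "s powi (int N - 2 * int k) = s ^ N / 2 ^ k"
      proof -
        have "s powi (int N - int (2 * k)) = s ^ N / s ^ (2 * k)"
          using s0 by (metis power_int_diff power_int_of_nat)
        then show ?thesis by (simp add: power_mult s_pow)
      qed
      moreover have "T ^ (N - k) = T ^ N / T ^ k"
        using T k by (simp add: power_diff)
      ultimately show "p (int N - int k) * T ^ (N - k) = - (p (int k) * (1 / (2 * T)) ^ k * (s ^ N * T ^ N))"
        unfolding p_sym by (simp add: power_divide power_mult_distrib)
    qed
    also have "\<dots> = - poly Q (1 / (2 * T)) * s ^ N * T ^ N"
      by (simp add: Q_poly sum_negf sum_distrib_right mult.assoc)
    finally show "poly P T = - poly P (1 / (2 * T)) * complex_of_real (2 powr g) * T powi \<lfloor>2 * g\<rfloor>"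
      by (simp add: \<open>P = Q\<close> two_g g_N)
  qed
qed

end
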